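(* Let $(\mathcal{X},\tau,\mathcal{B})$ be an effective topological space such that the set of all Type-2 names of points of $\mathcal{X}$ is a $\Pi^0_2$ subset of Baire space $\mathbb{N}^{\mathbb{N}}$. For $A\subseteq X_c$, the following are equivalent: (a) there is a $\Sigma^0_2$ set $I\subseteq\mathbb{N}$ such that for every $x\in X_c$ and every Markov name $e$ of $x$, $x\in A$ iff $e\in I$; (b) there exist effective open sets $\mathcal{U}^n_k,\mathcal{V}^n_k\subseteq\mathcal{X}$, uniformly in $n,k\in\mathbb{N}$, such that for every $k$, $A\cap X_c(k)=\bigcup_n(\mathcal{U}^n_k\setminus\mathcal{V}^n_k)\cap X_c(k)$.
   Context: Let $(\varphi_e)$ be a standard enumeration of partial computable functions, $W_e=\mathrm{dom}(\varphi_e)$. An effective topological space is $(\mathcal{X},\tau,\mathcal{B})$ with $(\mathcal{X},\tau)$ a non-empty topological space and $\mathcal{B}=(\mathcal{B}_i)_{i}$ a numbered basis with a total computable $g$ such that $\mathcal{B}_i\cap\mathcal{B}_j=\bigcup_{k\in W_{g(i,j)}}\mathcal{B}_k$. A Type-2 name of $x$ is any $p\in\mathbb{N}^{\mathbb{N}}$ with $\{p(n)\}=\{i:x\in\mathcal{B}_i\}$; $X_c$ is the set of points having a computable Type-2 name. A Markov name of $x\in X_c$ is an $e$ such that $\varphi_e$ is total and a Type-2 name of $x$. $K(x)$ is the length of a shortest program computing a Type-2 name of $x$, and $X_c(k)=\{x\in X_c:K(x)\leq k\}$. An effective open set is one of the form $\bigcup_{i\in W_e}\mathcal{B}_i$;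 a family is uniformly effective open if the index $e$ is computable from the parameters. $\Sigma^0_2$ refers to the arithmetical hierarchy on $\mathbb{N}$ and $\Pi^0_2$ to the effective Borel hierarchy on Baire space. *)

theory Defs
  imports
    "HOL-Analysis.Abstract_Topology"
    "HOL-Library.Nat_Bijection"
    "HOL-Library.Discrete_Functions"
begin

section \<open>Partial computable functions\<close>

text \<open>Kleene's \<open>\<mu>\<close>-recursive functions. Arities are left implicit: an application to a list
  of unsuitable length is simply undefined. \<open>PrimRec f g\<close> recurses on the first argument;
  \<open>Mu f\<close> searches for the least first argument at which \<open>f\<close> vanishes, and requires \<open>f\<close> to be
  defined at all smaller ones.\<close>

datatype recf =
    Zero
  | Succ
  | Proj nat
  | Comp recf "recf list"
  | PrimRec recf recf
  | Mu recf

inductive rec_eval :: "recf \<Rightarrow> nat list \<Rightarrow> nat \<Rightarrow> bool" where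
  Zero: "rec_eval Zero xs 0"
| Succ: "rec_eval Succ [x] (Suc x)"
| Proj: "i < length xs \<Longrightarrow> rec_eval (Proj i) xs (xs ! i)"
| Comp: "length ys = length gs \<Longrightarrow> (\<forall>i<length gs. rec_eval (gs ! i) xs (ys ! i)) \<Longrightarrow>
    rec_eval f ys z \<Longrightarrow> rec_eval (Comp f gs) xs z"
| PrimRec_0: "rec_eval f xs y \<Longrightarrow> rec_eval (PrimRec f g) (0 # xs) y"
| PrimRec_Suc: "rec_eval (PrimRec f g) (n # xs) y \<Longrightarrow> rec_eval g (n # y # xs) z \<Longrightarrow>
    rec_eval (PrimRec f g) (Suc n # xs) z"
| Mu: "rec_eval f (n # xs) 0 \<Longrightarrow> (\<forall>m<n. \<exists>y. rec_eval f (m # xs) (Suc y)) \<Longrightarrow>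
    rec_eval (Mu f) xs n"

text \<open>An \<open>n\<close>-ary function is represented by a function on lists, of which only the values on
  lists of length \<open>n\<close> matter.\<close>

definition partial_computable :: "nat \<Rightarrow> (nat list \<Rightarrow> nat option) \<Rightarrow> bool" where
  "partial_computable n f \<longleftrightarrow>
     (\<exists>r. \<forall>xs. length xs = n \<longrightarrow> (\<forall>y. f xs = Some y \<longleftrightarrow> rec_eval r xs y))"

definition total_computable :: "nat \<Rightarrow> (nat list \<Rightarrow> nat) \<Rightarrow> bool" where
  "total_computable n f \<longleftrightarrow> partial_computable n (\<lambda>xs. Some (f xs))"

definition decidable_pred :: "nat \<Rightarrow> (nat list \<Rightarrow> bool) \<Rightarrow> bool" where
  "decidable_pred n R \<longleftrightarrow> total_computable n (\<lambda>xs. if R xs then 1 else 0)"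

text \<open>A standard enumeration of the unary partial computable functions is an acceptable
  numbering in the sense of Rogers: it has a partial computable universal function, and every
  partial computable sequence of functions factors computably through it. Applied to constant
  sequences, the second clause shows that every unary partial computable function is listed.\<close>

definition acceptable_numbering :: "(nat \<Rightarrow> nat \<Rightarrow> nat option) \<Rightarrow> bool" where
  "acceptable_numbering \<phi> \<longleftrightarrow>
     partial_computable 2 (\<lambda>xs. \<phi> (xs ! 0) (xs ! 1)) \<and>
     (\<forall>\<psi> :: nat \<Rightarrow> nat \<Rightarrow> nat option. partial_computable 2 (\<lambda>xs. \<psi> (xs ! 0) (xs ! 1)) \<longrightarrow>
        (\<exists>s. total_computable 1 (\<lambda>xs. s (xs ! 0)) \<and> (\<forall>i. \<phi> (s i) = \<psi> i)))"

definition W :: "(nat \<Rightarrow> nat \<Rightarrow> nat option) \<Rightarrow> nat \<Rightarrow> nat set" where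
  "W \<phi> e = dom (\<phi> e)"

definition Sigma02_nat :: "nat set \<Rightarrow> bool" where
  "Sigma02_nat I \<longleftrightarrow>
     (\<exists>R :: nat \<Rightarrow> nat \<Rightarrow> nat \<Rightarrow> bool. decidable_pred 3 (\<lambda>xs. R (xs ! 0) (xs ! 1) (xs ! 2)) \<and>
        I = {e. \<exists>a. \<forall>b. R e a b})"

section \<open>Effective topological spaces\<close>

definition effective_open :: "(nat \<Rightarrow> nat \<Rightarrow> nat option) \<Rightarrow> (nat \<Rightarrow> 'a set) \<Rightarrow> nat \<Rightarrow> 'a set" where
  "effective_open \<phi> B e = (\<Union>i\<in>W \<phi> e. B i)"

definition uniformly_effective_open ::
    "(nat \<Rightarrow> nat \<Rightarrow> nat option) \<Rightarrow> (nat \<Rightarrow> 'a set) \<Rightarrow> (nat \<Rightarrow> 'a set) \<Rightarrow> bool" where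
  "uniformly_effective_open \<phi> B U \<longleftrightarrow>
     (\<exists>h. total_computable 1 (\<lambda>xs. h (xs ! 0)) \<and> (\<forall>n. U n = effective_open \<phi> B (h n)))"

definition uniformly_effective_open2 ::
    "(nat \<Rightarrow> nat \<Rightarrow> nat option) \<Rightarrow> (nat \<Rightarrow> 'a set) \<Rightarrow> (nat \<Rightarrow> nat \<Rightarrow> 'a set) \<Rightarrow> bool" where
  "uniformly_effective_open2 \<phi> B U \<longleftrightarrow>
     (\<exists>h. total_computable 2 (\<lambda>xs. h (xs ! 0) (xs ! 1)) \<and>
          (\<forall>n k. U n k = effective_open \<phi> B (h n k)))"

definition effective_topological_space ::
    "(nat \<Rightarrow> nat \<Rightarrow> nat option) \<Rightarrow> 'a topology \<Rightarrow> (nat \<Rightarrow> 'a set) \<Rightarrow> bool" where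
  "effective_topological_space \<phi> X B \<longleftrightarrow>
     topspace X \<noteq> {} \<and>
     openin X = arbitrary union_of (\<lambda>U. U \<in> range B) \<and>
     (\<exists>g. total_computable 2 (\<lambda>xs. g (xs ! 0) (xs ! 1)) \<and>
          (\<forall>i j. B i \<inter> B j = (\<Union>k\<in>W \<phi> (g i j). B k)))"

text \<open>The basic open sets of Baire space, numbered through the standard bijection between
  natural numbers and finite sequences.\<close>

definition cylinder :: "nat \<Rightarrow> (nat \<Rightarrow> nat) set" where
  "cylinder i = {p. \<forall>j<length (list_decode i). p j = list_decode i ! j}"

definition Pi02_baire :: "(nat \<Rightarrow> nat \<Rightarrow> nat option) \<Rightarrow> (nat \<Rightarrow> nat) set \<Rightarrow> bool" where
  "Pi02_baire \<phi> S \<longleftrightarrow> (\<exists>G. uniformly_effective_open \<phi> cylinder G \<and> S = (\<Inter>n. G n))"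

section \<open>Names and complexity of points\<close>

definition type2_name :: "(nat \<Rightarrow> 'a set) \<Rightarrow> 'a \<Rightarrow> (nat \<Rightarrow> nat) \<Rightarrow> bool" where
  "type2_name B x p \<longleftrightarrow> range p = {i. x \<in> B i}"

definition type2_names :: "'a topology \<Rightarrow> (nat \<Rightarrow> 'a set) \<Rightarrow> (nat \<Rightarrow> nat) set" where
  "type2_names X B = {p. \<exists>x\<in>topspace X. type2_name B x p}"

definition computable_points :: "'a topology \<Rightarrow> (nat \<Rightarrow> 'a set) \<Rightarrow> 'a set" where
  "computable_points X B =
     {x \<in> topspace X. \<exists>p. total_computable 1 (\<lambda>xs. p (xs ! 0)) \<and> type2_name B x p}"

definition markov_name ::
    "(nat \<Rightarrow> nat \<Rightarrow> nat option) \<Rightarrow> (nat \<Rightarrow> 'a set) \<Rightarrow> 'a \<Rightarrow> nat \<Rightarrow> bool" where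
  "markov_name \<phi> B x e \<longleftrightarrow> (\<exists>p. (\<forall>n. \<phi> e n = Some (p n)) \<and> type2_name B x p)"

text \<open>The program with index \<open>e\<close> is the \<open>e\<close>-th binary word in length-lexicographic order,
  that is, the binary expansion of \<open>e + 1\<close> without its leading digit.\<close>

definition program_length :: "nat \<Rightarrow> nat" where
  "program_length e = floor_log (e + 1)"

definition point_complexity ::
    "(nat \<Rightarrow> nat \<Rightarrow> nat option) \<Rightarrow> (nat \<Rightarrow> 'a set) \<Rightarrow> 'a \<Rightarrow> nat" where
  "point_complexity \<phi> B x = (LEAST l. \<exists>e. markov_name \<phi> B x e \<and> program_length e = l)"

definition computable_points_upto ::
    "(nat \<Rightarrow> nat \<Rightarrow> nat option) \<Rightarrow> 'a topology \<Rightarrow> (nat \<Rightarrow> 'a set) \<Rightarrow> nat \<Rightarrow> 'a set" where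
  "computable_points_upto \<phi> X B k =
     {x \<in> computable_points X B. point_complexity \<phi> B x \<le> k}"

end

theory Submission
  imports Defs
begin

text \<open>A Markov name \<open>e\<close> of \<open>x\<close> bounds the complexity of \<open>x\<close>, hence selects a \<open>k\<close> for which the given
  differences decide membership in \<open>A\<close>; as \<open>e\<close> enumerates all \<open>i\<close> with \<open>x \<in> B i\<close>, membership in an
  effective open set is semidecidable from \<open>e\<close>.

  Conversely, a point \<open>x\<close> of complexity at most \<open>k\<close> has a Markov name among the finitely many
  \<open>e < 2 ^ (k + 1)\<close>, so \<open>x \<in> A\<close> iff each of these \<open>e\<close> either is not a Markov name of \<open>x\<close> or lies in
  \<open>I\<close>. That \<open>e\<close> is not a Markov name of \<open>x\<close> means that no basic open set with index \<open>\<phi> e m\<close>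
  contains \<open>x\<close>, for some \<open>m\<close>, or that \<open>x \<in> B i\<close> for some \<open>i\<close> not listed by \<open>\<phi> e\<close>. So for each \<open>e\<close>
  the condition defines a countable union of differences of effective open sets, and such unions
  are closed under finite intersections.\<close>

section \<open>Closure properties of the computable functions\<close>

inductive_simps rec_eval_simps [simp]:
  "rec_eval Zero xs y"
  "rec_eval Succ xs y"
  "rec_eval (Proj i) xs y"
  "rec_eval (Comp f gs) xs y"
  "rec_eval (PrimRec f g) [] y"
  "rec_eval (PrimRec f g) (0 # xs) y"
  "rec_eval (PrimRec f g) (Suc m # xs) y"
  "rec_eval (Mu f) xs y"

lemma rec_eval_deterministic: "rec_eval r xs y \<Longrightarrow> rec_eval r xs z \<Longrightarrow> y = z"
proof (induction arbitrary: z rule: rec_eval.induct)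
  case (Comp ys gs xs f w)
  from Comp.prems obtain ys' where ys': "length ys' = length gs"
    "\<forall>i<length gs. rec_eval (gs ! i) xs (ys' ! i)" "rec_eval f ys' z"
    by auto
  have "ys = ys'"
    using Comp.hyps Comp.IH ys' by (intro nth_equalityI) auto
  then show ?case using Comp.IH ys' by auto
next
  case (PrimRec_0 f xs y g)
  from PrimRec_0.prems have "rec_eval f xs z" by simp
  then show ?case by (rule PrimRec_0.IH)
next
  case (PrimRec_Suc f g n xs y w)
  from PrimRec_Suc.prems obtain y' where
    "rec_eval (PrimRec f g) (n # xs) y'" "rec_eval g (n # y' # xs) z"
    by auto
  then show ?case using PrimRec_Suc.IH by blast
next
  case (Mu f n xs)
  from Mu.prems have z: "rec_eval f (z # xs) 0" "\<forall>m<z. \<exists>y. rec_eval f (m # xs) (Suc y)" by auto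
  show ?case
  proof (cases n z rule: linorder_cases)
    case less
    then show ?thesis using z(2) Mu.IH by blast
  next
    case greater
    then show ?thesis using z(1) Mu.IH by blast
  qed
qed simp_all

lemma total_computable_iff:
  "total_computable n f \<longleftrightarrow> (\<exists>r. \<forall>xs. length xs = n \<longrightarrow> rec_eval r xs (f xs))"
  unfolding total_computable_def partial_computable_def
  by (metis option.inject rec_eval_deterministic)

lemma total_computable_cong:
  assumes "total_computable n f" "\<And>xs. length xs = n \<Longrightarrow> f xs = g xs"
  shows "total_computable n g"
  using assms unfolding total_computable_iff by metis

definition computable_map :: "nat \<Rightarrow> nat \<Rightarrow> (nat list \<Rightarrow> nat list) \<Rightarrow> bool" where
  "computable_map n m G \<longleftrightarrow> (\<forall>xs. length xs = n \<longrightarrow> length (G xs) = m) \<and>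
     (\<forall>i<m. total_computable n (\<lambda>xs. G xs ! i))"

lemma total_computable_comp:
  assumes "total_computable m F" "computable_map n m G"
  shows "total_computable n (\<lambda>xs. F (G xs))"
proof -
  obtain rF where rF: "\<And>xs. length xs = m \<Longrightarrow> rec_eval rF xs (F xs)"
    using assms(1) unfolding total_computable_iff by blast
  obtain r where r: "\<And>i xs. i < m \<Longrightarrow> length xs = n \<Longrightarrow> rec_eval (r i) xs (G xs ! i)"
    using assms(2) unfolding computable_map_def total_computable_iff by metis
  have "rec_eval (Comp rF (map r [0..<m])) xs (F (G xs))" if "length xs = n" for xs
    using that rF r assms(2)
    by (intro rec_eval.Comp[where ys = "G xs"]) (auto simp: computable_map_def)
  then show ?thesis unfolding total_computable_iff by blast
qed

lemma computable_map_comp: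
  assumes "computable_map m l G" "computable_map n m H"
  shows "computable_map n l (\<lambda>xs. G (H xs))"
  using assms total_computable_comp[OF _ assms(2), of "\<lambda>xs. G xs ! _"]
  by (simp add: computable_map_def)

lemma decidable_pred_comp:
  assumes "decidable_pred m P" "computable_map n m G"
  shows "decidable_pred n (\<lambda>xs. P (G xs))"
  using total_computable_comp[OF assms(1)[unfolded decidable_pred_def] assms(2)]
  unfolding decidable_pred_def .

named_theorems computable

lemma total_computable_nth [computable]:
  assumes "computable_map n m G" "i < m"
  shows "total_computable n (\<lambda>xs. G xs ! i)"
  using assms by (simp add: computable_map_def)

lemma computable_map_id [computable]: "computable_map n n (\<lambda>xs. xs)"
proof -
  have "total_computable n (\<lambda>xs. xs ! i)" if "i < n" for i
    unfolding total_computable_iff using that by (intro exI[of _ "Proj i"]) simp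
  then show ?thesis by (simp add: computable_map_def)
qed

lemma computable_map_Nil [computable]: "computable_map n 0 (\<lambda>xs. [])"
  by (simp add: computable_map_def)

lemma computable_map_Cons [computable]:
  assumes "total_computable n f" "computable_map n m G"
  shows "computable_map n (Suc m) (\<lambda>xs. f xs # G xs)"
  using assms by (auto simp: computable_map_def less_Suc_eq_0_disj)

lemma computable_map_map_upt:
  assumes "\<And>i. i < m \<Longrightarrow> total_computable n (F i)"
  shows "computable_map n m (\<lambda>xs. map (\<lambda>i. F i xs) [0..<m])"
  using assms by (simp add: computable_map_def)

lemma computable_map_tl [computable]:
  assumes "computable_map n (Suc m) G"
  shows "computable_map n m (\<lambda>xs. tl (G xs))"
proof -
  have "total_computable n (\<lambda>xs. tl (G xs) ! i)" if "i < m" for i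
  proof (rule total_computable_cong)
    show "total_computable n (\<lambda>xs. G xs ! Suc i)"
      using assms that by (simp add: computable_map_def)
  qed (use assms that in \<open>simp add: computable_map_def nth_tl\<close>)
  then show ?thesis using assms by (simp add: computable_map_def)
qed

lemma total_computable_comp1:
  assumes "total_computable 1 (\<lambda>xs. F (xs ! 0))" "total_computable n f"
  shows "total_computable n (\<lambda>xs. F (f xs))"
  using total_computable_comp[OF assms(1), of n "\<lambda>xs. [f xs]"] assms(2)
  by (simp add: computable)

lemma total_computable_comp2:
  assumes "total_computable 2 (\<lambda>xs. F (xs ! 0) (xs ! 1))"
    "total_computable n f" "total_computable n g"
  shows "total_computable n (\<lambda>xs. F (f xs) (g xs))"
  using total_computable_comp[OF assms(1), of n "\<lambda>xs. [f xs, g xs]"] assms(2-)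
  by (simp add: computable numeral_2_eq_2)

lemma decidable_pred_comp3:
  assumes "decidable_pred 3 (\<lambda>xs. P (xs ! 0) (xs ! 1) (xs ! 2))"
    "total_computable n f" "total_computable n g" "total_computable n h"
  shows "decidable_pred n (\<lambda>xs. P (f xs) (g xs) (h xs))"
  using decidable_pred_comp[OF assms(1), of n "\<lambda>xs. [f xs, g xs, h xs]"] assms(2-)
  by (simp add: computable eval_nat_numeral)

lemma decidable_pred_comp_Cons:
  assumes "decidable_pred (Suc m) (\<lambda>xs. P (xs ! 0) (tl xs))"
    "total_computable n f" "computable_map n m G"
  shows "decidable_pred n (\<lambda>xs. P (f xs) (G xs))"
  using decidable_pred_comp[OF assms(1) computable_map_Cons[OF assms(2,3)]] by simp

lemma total_computable_Suc [computable]: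
  assumes "total_computable n f"
  shows "total_computable n (\<lambda>xs. Suc (f xs))"
proof (rule total_computable_comp1[OF _ assms])
  show "total_computable 1 (\<lambda>xs. Suc (xs ! 0))"
    unfolding total_computable_iff by (intro exI[of _ Succ]) (auto simp: length_Suc_conv)
qed

lemma total_computable_const [computable]: "total_computable n (\<lambda>xs. c)"
proof (induction c)
  case 0
  show ?case unfolding total_computable_iff by (intro exI[of _ Zero]) simp
qed (rule total_computable_Suc)

lemma total_computable_rec_nat [computable]:
  assumes "total_computable n a"
    and "total_computable (Suc (Suc n)) (\<lambda>xs. b (xs ! 0) (xs ! 1) (tl (tl xs)))"
    and "total_computable n t"
  shows "total_computable n (\<lambda>xs. rec_nat (a xs) (\<lambda>m v. b m v xs) (t xs))"
proof -
  obtain ra where ra: "\<And>xs. length xs = n \<Longrightarrow> rec_eval ra xs (a xs)"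
    using assms(1) unfolding total_computable_iff by blast
  obtain rb where rb: "\<And>xs. length xs = Suc (Suc n) \<Longrightarrow>
      rec_eval rb xs (b (xs ! 0) (xs ! 1) (tl (tl xs)))"
    using assms(2) unfolding total_computable_iff by blast
  have "rec_eval (PrimRec ra rb) (m # xs) (rec_nat (a xs) (\<lambda>m v. b m v xs) m)"
    if "length xs = n" for m xs
  proof (induction m)
    case 0
    show ?case by (simp add: ra that)
  next
    case (Suc m)
    with rb[of "m # rec_nat (a xs) (\<lambda>m v. b m v xs) m # xs"] show ?case
      by (auto intro!: rec_eval.PrimRec_Suc simp: that)
  qed
  then have "total_computable (Suc n) (\<lambda>xs. rec_nat (a (tl xs)) (\<lambda>m v. b m v (tl xs)) (xs ! 0))"
    unfolding total_computable_iff
    by (intro exI[of _ "PrimRec ra rb"]) (auto simp: length_Suc_conv)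
  from total_computable_comp[OF this computable_map_Cons[OF assms(3) computable_map_id]]
  show ?thesis by simp
qed

lemma total_computable_if [computable]:
  assumes "decidable_pred n P" "total_computable n f" "total_computable n g"
  shows "total_computable n (\<lambda>xs. if P xs then f xs else g xs)"
proof -
  have "total_computable n (\<lambda>xs. rec_nat (g xs) (\<lambda>_ _. f xs) (if P xs then 1 else 0))"
    by (rule computable total_computable_comp[OF assms(2)] assms(3)
        assms(1)[unfolded decidable_pred_def])+
  then show ?thesis by (rule total_computable_cong) simp
qed

lemma decidable_pred_const [computable]: "decidable_pred n (\<lambda>xs. c)"
  unfolding decidable_pred_def by (rule total_computable_const)

lemma decidable_pred_not [computable]:
  assumes "decidable_pred n P"
  shows "decidable_pred n (\<lambda>xs. \<not> P xs)"
  using total_computable_if[OF assms total_computable_const[of n 0] total_computable_const[of n 1]]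
  unfolding decidable_pred_def by (rule total_computable_cong) simp

lemma decidable_pred_conj [computable]:
  assumes "decidable_pred n P" "decidable_pred n Q"
  shows "decidable_pred n (\<lambda>xs. P xs \<and> Q xs)"
  using total_computable_if[OF assms(1) assms(2)[unfolded decidable_pred_def]
      total_computable_const[of n 0]]
  unfolding decidable_pred_def by (rule total_computable_cong) simp

lemma decidable_pred_disj [computable]:
  assumes "decidable_pred n P" "decidable_pred n Q"
  shows "decidable_pred n (\<lambda>xs. P xs \<or> Q xs)"
  using decidable_pred_not[OF decidable_pred_conj[OF assms[THEN decidable_pred_not]]] by simp

lemma decidable_pred_eq_0:
  assumes "total_computable n f"
  shows "decidable_pred n (\<lambda>xs. f xs = 0)"
proof -
  have "total_computable n (\<lambda>xs. rec_nat 1 (\<lambda>_ _. 0) (f xs))"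
    by (rule computable assms | simp)+
  moreover have "rec_nat 1 (\<lambda>_ _. 0) m = (if m = 0 then 1 else (0::nat))" for m
    by (cases m) auto
  ultimately show ?thesis unfolding decidable_pred_def by simp
qed

lemma total_computable_add [computable]:
  assumes "total_computable n f" "total_computable n g"
  shows "total_computable n (\<lambda>xs. f xs + g xs)"
proof -
  have "rec_nat a (\<lambda>_ v. Suc v) b = a + b" for a b by (induction b) auto
  moreover have "total_computable n (\<lambda>xs. rec_nat (f xs) (\<lambda>_ v. Suc v) (g xs))"
    by (rule computable assms | simp)+
  ultimately show ?thesis by simp
qed

lemma total_computable_diff [computable]:
  assumes "total_computable n f" "total_computable n g"
  shows "total_computable n (\<lambda>xs. f xs - g xs)"
proof -
  have pred: "rec_nat 0 (\<lambda>m _. m) b = b - 1" for b by (cases b) auto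
  have "rec_nat a (\<lambda>_ v. rec_nat 0 (\<lambda>m _. m) v) b = a - b" for a b
    by (induction b) (auto simp: pred)
  moreover have "total_computable n (\<lambda>xs. rec_nat (f xs) (\<lambda>_ v. rec_nat 0 (\<lambda>m _. m) v) (g xs))"
    by (rule computable assms | simp)+
  ultimately show ?thesis by simp
qed

lemma total_computable_mult [computable]:
  assumes "total_computable n f" "total_computable n g"
  shows "total_computable n (\<lambda>xs. f xs * g xs)"
proof -
  have "rec_nat 0 (\<lambda>_ v. v + a) b = a * b" for a b :: nat by (induction b) auto
  moreover have "total_computable n (\<lambda>xs. rec_nat 0 (\<lambda>_ v. v + f xs) (g xs))"
    by (rule computable total_computable_comp[OF assms(1)] assms(2) | simp)+
  ultimately show ?thesis by simp
qed

lemma total_computable_power [computable]: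
  assumes "total_computable n f" "total_computable n g"
  shows "total_computable n (\<lambda>xs. f xs ^ g xs)"
proof -
  have "rec_nat 1 (\<lambda>_ v. v * a) b = a ^ b" for a b :: nat by (induction b) auto
  moreover have "total_computable n (\<lambda>xs. rec_nat 1 (\<lambda>_ v. v * f xs) (g xs))"
    by (rule computable total_computable_comp[OF assms(1)] assms(2) | simp)+
  ultimately show ?thesis by simp
qed

lemma decidable_pred_le [computable]:
  assumes "total_computable n f" "total_computable n g"
  shows "decidable_pred n (\<lambda>xs. f xs \<le> g xs)"
  using decidable_pred_eq_0[OF total_computable_diff[OF assms]] by simp

lemma decidable_pred_less [computable]:
  assumes "total_computable n f" "total_computable n g"
  shows "decidable_pred n (\<lambda>xs. f xs < g xs)"
  using decidable_pred_not[OF decidable_pred_le[OF assms(2,1)]] by (simp add: not_le)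

lemma decidable_pred_eq [computable]:
  assumes "total_computable n f" "total_computable n g"
  shows "decidable_pred n (\<lambda>xs. f xs = g xs)"
  using decidable_pred_conj[OF decidable_pred_le[OF assms] decidable_pred_le[OF assms(2,1)]]
  by (simp add: eq_iff)

lemma rec_eval_Mu_Least:
  assumes "\<And>m. rec_eval r (m # xs) (if P m then 0 else 1)"
  shows "rec_eval (Mu r) xs y \<longleftrightarrow> (\<exists>y. P y) \<and> y = (LEAST y. P y)"
proof -
  have "rec_eval r (m # xs) z \<longleftrightarrow> z = (if P m then 0 else 1)" for m z
    using assms rec_eval_deterministic by blast
  then have "rec_eval (Mu r) xs y \<longleftrightarrow> P y \<and> (\<forall>m<y. \<not> P m)"
    by auto
  also have "\<dots> \<longleftrightarrow> (\<exists>y. P y) \<and> y = (LEAST y. P y)"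
    by (metis LeastI_ex Least_equality not_less not_less_Least)
  finally show ?thesis .
qed

lemma partial_computable_Least:
  assumes "decidable_pred (Suc n) (\<lambda>xs. P (xs ! 0) (tl xs))"
  shows "partial_computable n (\<lambda>xs. if \<exists>y. P y xs then Some (LEAST y. P y xs) else None)"
proof -
  have "total_computable (Suc n) (\<lambda>xs. if P (xs ! 0) (tl xs) then 0 else 1)"
    by (rule computable assms | simp)+
  then obtain r where r: "\<And>xs. length xs = Suc n \<Longrightarrow>
      rec_eval r xs (if P (xs ! 0) (tl xs) then 0 else 1)"
    unfolding total_computable_iff by blast
  have "rec_eval (Mu r) xs y \<longleftrightarrow> (\<exists>y. P y xs) \<and> y = (LEAST y. P y xs)"
    if "length xs = n" for xs y
    using r[of "_ # xs"] that by (intro rec_eval_Mu_Least) simp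
  then show ?thesis
    unfolding partial_computable_def by (intro exI[of _ "Mu r"]) auto
qed

lemma total_computable_Least:
  assumes "decidable_pred (Suc n) (\<lambda>xs. P (xs ! 0) (tl xs))"
    and "\<And>xs. length xs = n \<Longrightarrow> \<exists>y. P y xs"
  shows "total_computable n (\<lambda>xs. LEAST y. P y xs)"
  using partial_computable_Least[OF assms(1)] assms(2)
  unfolding total_computable_def partial_computable_def by simp

lemma decidable_pred_all_less [computable]:
  assumes "decidable_pred (Suc n) (\<lambda>xs. P (xs ! 0) (tl xs))" "total_computable n t"
  shows "decidable_pred n (\<lambda>xs. \<forall>y<t xs. P y xs)"
proof -
  have "decidable_pred (Suc n) (\<lambda>xs. xs ! 0 = t (tl xs) \<or> \<not> P (xs ! 0) (tl xs))"
    by (rule computable total_computable_comp[OF assms(2)] assms(1) | simp)+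
  then have Least: "total_computable n (\<lambda>xs. LEAST y. y = t xs \<or> \<not> P y xs)"
    by (rule total_computable_Least) blast
  have "decidable_pred n (\<lambda>xs. t xs \<le> (LEAST y. y = t xs \<or> \<not> P y xs))"
    by (rule computable Least assms(2))+
  moreover have "b \<le> (LEAST y. y = b \<or> \<not> Q y) \<longleftrightarrow> (\<forall>y<b. Q y)" (is "b \<le> ?l \<longleftrightarrow> _")
    for b :: nat and Q
  proof
    assume "b \<le> ?l"
    then show "\<forall>y<b. Q y" using not_less_Least[of _ "\<lambda>y. y = b \<or> \<not> Q y"] by (meson less_le_trans)
  next
    assume "\<forall>y<b. Q y"
    moreover have "?l = b \<or> \<not> Q ?l" by (rule LeastI[of _ b]) simp
    ultimately show "b \<le> ?l" by (cases "?l < b") auto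
  qed
  ultimately show ?thesis by simp
qed

lemma decidable_pred_ex_less [computable]:
  assumes "decidable_pred (Suc n) (\<lambda>xs. P (xs ! 0) (tl xs))" "total_computable n t"
  shows "decidable_pred n (\<lambda>xs. \<exists>y<t xs. P y xs)"
  using decidable_pred_not[OF decidable_pred_all_less[OF decidable_pred_not[OF assms(1)] assms(2)]]
  by simp

section \<open>Coding of pairs and sequences\<close>

lemma total_computable_prod_encode [computable]:
  assumes "total_computable n f" "total_computable n g"
  shows "total_computable n (\<lambda>xs. prod_encode (f xs, g xs))"
proof -
  have "rec_nat 0 (\<lambda>m v. v + Suc m) b = triangle b" for b
    by (induction b) auto
  moreover have "total_computable n (\<lambda>xs. rec_nat 0 (\<lambda>m v. v + Suc m) (f xs + g xs) + f xs)"
    by (rule computable assms | simp)+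
  ultimately show ?thesis by (simp add: prod_encode_def)
qed

lemma total_computable_fst_prod_decode [computable]:
  assumes "total_computable n f"
  shows "total_computable n (\<lambda>xs. fst (prod_decode (f xs)))"
proof (rule total_computable_comp1[OF _ assms])
  have decode: "\<exists>b<Suc z. prod_encode (fst (prod_decode z), b) = z" for z
    using le_prod_encode_2[of "snd (prod_decode z)" "fst (prod_decode z)"]
    by (intro exI[of _ "snd (prod_decode z)"]) (simp add: less_Suc_eq_le)
  then have "fst (prod_decode z) = (LEAST a. \<exists>b<Suc z. prod_encode (a, b) = z)" for z
    by (intro Least_equality[symmetric]) auto
  moreover have "total_computable 1 (\<lambda>xs. LEAST a. \<exists>b<Suc (xs ! 0). prod_encode (a, b) = xs ! 0)"
  proof (rule total_computable_Least)
    show "decidable_pred (Suc 1) (\<lambda>xs. \<exists>b<Suc (tl xs ! 0). prod_encode (xs ! 0, b) = tl xs ! 0)"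
      by (rule computable | simp)+
  qed (use decode in blast)
  ultimately show "total_computable 1 (\<lambda>xs. fst (prod_decode (xs ! 0)))" by simp
qed

lemma total_computable_snd_prod_decode [computable]:
  assumes "total_computable n f"
  shows "total_computable n (\<lambda>xs. snd (prod_decode (f xs)))"
proof (rule total_computable_comp1[OF _ assms])
  have decode: "prod_encode (fst (prod_decode z), b) = z \<longleftrightarrow> b = snd (prod_decode z)" for b z
    by (metis prod_decode_inverse prod_encode_inverse prod.collapse snd_conv)
  then have "(LEAST b. prod_encode (fst (prod_decode z), b) = z) = snd (prod_decode z)" for z
    by (intro Least_equality) auto
  moreover have "total_computable 1
      (\<lambda>xs. LEAST b. prod_encode (fst (prod_decode (xs ! 0)), b) = xs ! 0)"
  proof (rule total_computable_Least)
    show "decidable_pred (Suc 1)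
        (\<lambda>xs. prod_encode (fst (prod_decode (tl xs ! 0)), xs ! 0) = tl xs ! 0)"
      by (rule computable | simp)+
  qed (simp add: decode)
  ultimately show "total_computable 1 (\<lambda>xs. snd (prod_decode (xs ! 0)))" by simp
qed

lemma ex_prod_decode: "(\<exists>z. P (fst (prod_decode z)) (snd (prod_decode z))) \<longleftrightarrow> (\<exists>a b. P a b)"
  by (metis fst_conv prod_encode_inverse snd_conv)

text \<open>In contrast to \<^const>\<open>list_decode\<close>, this reads a number as an infinite sequence, so that
  \<open>entry\<close> is a total computable function.\<close>

primrec entry :: "nat \<Rightarrow> nat \<Rightarrow> nat" where
  "entry c 0 = fst (prod_decode c)"
| "entry c (Suc i) = entry (snd (prod_decode c)) i"

lemma total_computable_entry [computable]:
  assumes "total_computable n f" "total_computable n g"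
  shows "total_computable n (\<lambda>xs. entry (f xs) (g xs))"
proof -
  let ?tail = "\<lambda>c i. rec_nat c (\<lambda>_ v. snd (prod_decode v)) i"
  have "?tail (snd (prod_decode c)) i = snd (prod_decode (?tail c i))" for c i
    by (induction i) auto
  then have "entry c i = fst (prod_decode (?tail c i))" for c i
    by (induction i arbitrary: c) simp_all
  moreover have "total_computable n (\<lambda>xs. fst (prod_decode (?tail (f xs) (g xs))))"
    by (rule computable assms | simp)+
  ultimately show ?thesis by simp
qed

lemma ex_entry_eq: "\<exists>c. \<forall>i<N. entry c i = f i"
proof (induction N arbitrary: f)
  case (Suc N)
  obtain c where "\<forall>i<N. entry c i = f (Suc i)" using Suc[of "\<lambda>i. f (Suc i)"] by blast
  then have "\<forall>i<Suc N. entry (prod_encode (f 0, c)) i = f i"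
    by (auto simp: less_Suc_eq_0_disj)
  then show ?case by blast
qed simp

lemma all_less_ex_iff_ex_entry: "(\<forall>i<N. \<exists>s. P i s) \<longleftrightarrow> (\<exists>c. \<forall>i<N. P i (entry c i))"
proof
  assume "\<forall>i<N. \<exists>s. P i s"
  then obtain f where "\<forall>i<N. P i (f i)" by metis
  then show "\<exists>c. \<forall>i<N. P i (entry c i)" using ex_entry_eq[of N f] by metis
qed blast

section \<open>Semidecidable predicates\<close>

definition semidecidable_pred :: "nat \<Rightarrow> (nat list \<Rightarrow> bool) \<Rightarrow> bool" where
  "semidecidable_pred n P \<longleftrightarrow>
     (\<exists>R. decidable_pred (Suc n) (\<lambda>xs. R (xs ! 0) (tl xs)) \<and>
          (\<forall>xs. length xs = n \<longrightarrow> (P xs \<longleftrightarrow> (\<exists>s. R s xs))))"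

lemma semidecidable_predI:
  assumes "decidable_pred (Suc n) (\<lambda>xs. R (xs ! 0) (tl xs))"
    and "\<And>xs. length xs = n \<Longrightarrow> P xs \<longleftrightarrow> (\<exists>s. R s xs)"
  shows "semidecidable_pred n P"
  using assms unfolding semidecidable_pred_def by blast

lemma semidecidable_predE:
  assumes "semidecidable_pred n P"
  obtains R where "decidable_pred (Suc n) (\<lambda>xs. R (xs ! 0) (tl xs))"
    "\<And>xs. length xs = n \<Longrightarrow> P xs \<longleftrightarrow> (\<exists>s. R s xs)"
  using assms unfolding semidecidable_pred_def by blast

lemma semidecidable_pred_cong:
  assumes "semidecidable_pred n P" "\<And>xs. length xs = n \<Longrightarrow> P xs \<longleftrightarrow> Q xs"
  shows "semidecidable_pred n Q"
  using assms unfolding semidecidable_pred_def by simp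

lemma semidecidable_pred_comp:
  assumes "semidecidable_pred m P" "computable_map n m G"
  shows "semidecidable_pred n (\<lambda>xs. P (G xs))"
proof -
  obtain R where R: "decidable_pred (Suc m) (\<lambda>xs. R (xs ! 0) (tl xs))"
    "\<And>xs. length xs = m \<Longrightarrow> P xs \<longleftrightarrow> (\<exists>s. R s xs)"
    using assms(1) by (rule semidecidable_predE) blast
  show ?thesis
  proof (rule semidecidable_predI)
    show "decidable_pred (Suc n) (\<lambda>xs. R (xs ! 0) (G (tl xs)))"
      by (rule decidable_pred_comp_Cons[OF R(1)] computable_map_comp[OF assms(2)] computable
          | simp)+
  qed (use R(2) assms(2) in \<open>simp add: computable_map_def\<close>)
qed

lemma semidecidable_pred_comp_Cons:
  assumes "semidecidable_pred (Suc m) (\<lambda>xs. P (xs ! 0) (tl xs))"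
    "total_computable n f" "computable_map n m G"
  shows "semidecidable_pred n (\<lambda>xs. P (f xs) (G xs))"
  using semidecidable_pred_comp[OF assms(1) computable_map_Cons[OF assms(2,3)]] by simp

lemma semidecidable_pred_decidable:
  assumes "decidable_pred n P"
  shows "semidecidable_pred n P"
  by (rule semidecidable_predI[of _ "\<lambda>_. P"])
    (simp_all add: decidable_pred_comp[OF assms] computable)

lemmas semidecidable_pred_atoms [computable] =
  semidecidable_pred_decidable[OF decidable_pred_const]
  semidecidable_pred_decidable[OF decidable_pred_less]
  semidecidable_pred_decidable[OF decidable_pred_eq]

lemma semidecidable_pred_ex [computable]:
  assumes "semidecidable_pred (Suc n) (\<lambda>xs. P (xs ! 0) (tl xs))"
  shows "semidecidable_pred n (\<lambda>xs. \<exists>y. P y xs)"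
proof -
  obtain R where R: "decidable_pred (Suc (Suc n)) (\<lambda>xs. R (xs ! 0) (tl xs))"
    "\<And>xs. length xs = Suc n \<Longrightarrow> P (xs ! 0) (tl xs) \<longleftrightarrow> (\<exists>s. R s xs)"
    using assms by (rule semidecidable_predE) blast
  show ?thesis
  proof (rule semidecidable_predI)
    show "decidable_pred (Suc n)
        (\<lambda>xs. R (fst (prod_decode (xs ! 0))) (snd (prod_decode (xs ! 0)) # tl xs))"
      by (rule computable decidable_pred_comp_Cons[OF R(1)] | simp)+
    show "(\<exists>y. P y xs) \<longleftrightarrow> (\<exists>z. R (fst (prod_decode z)) (snd (prod_decode z) # xs))"
      if "length xs = n" for xs
      using R(2)[of "_ # xs"] that by (simp add: ex_prod_decode[of "\<lambda>s y. R s (y # xs)"]) blast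
  qed
qed

lemma semidecidable_pred_conj [computable]:
  assumes "semidecidable_pred n P" "semidecidable_pred n Q"
  shows "semidecidable_pred n (\<lambda>xs. P xs \<and> Q xs)"
proof -
  obtain R where R: "decidable_pred (Suc n) (\<lambda>xs. R (xs ! 0) (tl xs))"
    "\<And>xs. length xs = n \<Longrightarrow> P xs \<longleftrightarrow> (\<exists>s. R s xs)"
    using assms(1) by (rule semidecidable_predE) blast
  obtain R' where R': "decidable_pred (Suc n) (\<lambda>xs. R' (xs ! 0) (tl xs))"
    "\<And>xs. length xs = n \<Longrightarrow> Q xs \<longleftrightarrow> (\<exists>s. R' s xs)"
    using assms(2) by (rule semidecidable_predE) blast
  have "semidecidable_pred n (\<lambda>xs. \<exists>s s'. R s xs \<and> R' s' xs)"
    by (rule computable semidecidable_pred_decidable decidable_pred_comp_Cons[OF R(1)]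
        decidable_pred_comp_Cons[OF R'(1)] | simp)+
  then show ?thesis by (rule semidecidable_pred_cong) (simp add: R(2) R'(2))
qed

lemma semidecidable_pred_disj [computable]:
  assumes "semidecidable_pred n P" "semidecidable_pred n Q"
  shows "semidecidable_pred n (\<lambda>xs. P xs \<or> Q xs)"
proof -
  obtain R where R: "decidable_pred (Suc n) (\<lambda>xs. R (xs ! 0) (tl xs))"
    "\<And>xs. length xs = n \<Longrightarrow> P xs \<longleftrightarrow> (\<exists>s. R s xs)"
    using assms(1) by (rule semidecidable_predE) blast
  obtain R' where R': "decidable_pred (Suc n) (\<lambda>xs. R' (xs ! 0) (tl xs))"
    "\<And>xs. length xs = n \<Longrightarrow> Q xs \<longleftrightarrow> (\<exists>s. R' s xs)"
    using assms(2) by (rule semidecidable_predE) blast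
  show ?thesis
    by (rule semidecidable_predI[OF decidable_pred_disj[OF R(1) R'(1)]]) (auto simp: R(2) R'(2))
qed

lemma semidecidable_pred_all_less [computable]:
  assumes "semidecidable_pred (Suc n) (\<lambda>xs. P (xs ! 0) (tl xs))" "total_computable n t"
  shows "semidecidable_pred n (\<lambda>xs. \<forall>y<t xs. P y xs)"
proof -
  obtain R where R: "decidable_pred (Suc (Suc n)) (\<lambda>xs. R (xs ! 0) (tl xs))"
    "\<And>xs. length xs = Suc n \<Longrightarrow> P (xs ! 0) (tl xs) \<longleftrightarrow> (\<exists>s. R s xs)"
    using assms(1) by (rule semidecidable_predE) blast
  show ?thesis
  proof (rule semidecidable_predI)
    show "decidable_pred (Suc n) (\<lambda>xs. \<forall>y<t (tl xs). R (entry (xs ! 0) y) (y # tl xs))"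
      by (rule computable decidable_pred_comp_Cons[OF R(1)] total_computable_comp[OF assms(2)]
          | simp)+
    show "(\<forall>y<t xs. P y xs) \<longleftrightarrow> (\<exists>c. \<forall>y<t xs. R (entry c y) (y # xs))" if "length xs = n" for xs
      using R(2)[of "_ # xs"] that by (simp add: all_less_ex_iff_ex_entry)
  qed
qed

lemma semidecidable_pred_all_less_const:
  fixes m :: nat
  assumes "\<And>i. i < m \<Longrightarrow> semidecidable_pred n (P i)"
  shows "semidecidable_pred n (\<lambda>xs. \<forall>i<m. P i xs)"
  using assms
proof (induction m)
  case 0
  show ?case by (simp add: computable)
next
  case (Suc m)
  then show ?case unfolding All_less_Suc by (intro semidecidable_pred_conj) simp_all
qed

lemma semidecidable_pred_const_conj:
  assumes "C \<Longrightarrow> semidecidable_pred n P"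
  shows "semidecidable_pred n (\<lambda>xs. C \<and> P xs)"
  using assms by (cases C) (simp_all add: computable)

lemma rec_eval_Comp_iff_ex_entry:
  "rec_eval (Comp f gs) xs y \<longleftrightarrow> (\<exists>c. (\<forall>i<length gs. rec_eval (gs ! i) xs (entry c i)) \<and>
     rec_eval f (map (entry c) [0..<length gs]) y)"
proof
  assume "rec_eval (Comp f gs) xs y"
  then obtain ys where ys: "length ys = length gs" "\<forall>i<length gs. rec_eval (gs ! i) xs (ys ! i)"
    "rec_eval f ys y" by auto
  obtain c where c: "\<forall>i<length gs. entry c i = ys ! i" using ex_entry_eq by blast
  then have "map (entry c) [0..<length gs] = ys" using ys(1) by (intro nth_equalityI) simp_all
  then show "\<exists>c. (\<forall>i<length gs. rec_eval (gs ! i) xs (entry c i)) \<and>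
      rec_eval f (map (entry c) [0..<length gs]) y"
    using ys c by (intro exI[of _ c]) simp
next
  assume "\<exists>c. (\<forall>i<length gs. rec_eval (gs ! i) xs (entry c i)) \<and>
      rec_eval f (map (entry c) [0..<length gs]) y"
  then obtain c where "\<forall>i<length gs. rec_eval (gs ! i) xs (entry c i)"
    "rec_eval f (map (entry c) [0..<length gs]) y" by blast
  then show "rec_eval (Comp f gs) xs y"
    by (intro rec_eval.Comp[of "map (entry c) [0..<length gs]"]) simp_all
qed

lemma rec_eval_PrimRec_iff:
  "rec_eval (PrimRec f g) (m # xs) y \<longleftrightarrow> (\<exists>v. rec_eval f xs (v 0) \<and>
     (\<forall>i<m. rec_eval g (i # v i # xs) (v (Suc i))) \<and> v m = y)"
proof (induction m arbitrary: y)
  case 0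
  show ?case by (auto intro: exI[of _ "\<lambda>_. y"])
next
  case (Suc m)
  show ?case
  proof
    assume "rec_eval (PrimRec f g) (Suc m # xs) y"
    then obtain v where "rec_eval f xs (v 0)" "\<forall>i<m. rec_eval g (i # v i # xs) (v (Suc i))"
      "rec_eval g (m # v m # xs) y" using Suc.IH by auto
    then show "\<exists>v. rec_eval f xs (v 0) \<and>
        (\<forall>i<Suc m. rec_eval g (i # v i # xs) (v (Suc i))) \<and> v (Suc m) = y"
      by (intro exI[of _ "v(Suc m := y)"]) (auto simp: less_Suc_eq)
  next
    assume "\<exists>v. rec_eval f xs (v 0) \<and>
        (\<forall>i<Suc m. rec_eval g (i # v i # xs) (v (Suc i))) \<and> v (Suc m) = y"
    then obtain v where v: "rec_eval f xs (v 0)"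
      "\<forall>i<Suc m. rec_eval g (i # v i # xs) (v (Suc i))" "v (Suc m) = y" by blast
    then have "rec_eval (PrimRec f g) (m # xs) (v m)" unfolding Suc.IH by auto
    then show "rec_eval (PrimRec f g) (Suc m # xs) y" using v by auto
  qed
qed

lemma rec_eval_PrimRec_iff_ex_entry:
  "rec_eval (PrimRec f g) (m # xs) y \<longleftrightarrow> (\<exists>c. rec_eval f xs (entry c 0) \<and>
     (\<forall>i<m. rec_eval g (i # entry c i # xs) (entry c (Suc i))) \<and> entry c m = y)"
proof
  assume "rec_eval (PrimRec f g) (m # xs) y"
  then obtain v where v: "rec_eval f xs (v 0)"
    "\<forall>i<m. rec_eval g (i # v i # xs) (v (Suc i))" "v m = y"
    unfolding rec_eval_PrimRec_iff by blast
  obtain c where c: "\<forall>i<Suc m. entry c i = v i" using ex_entry_eq by blast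
  show "\<exists>c. rec_eval f xs (entry c 0) \<and>
      (\<forall>i<m. rec_eval g (i # entry c i # xs) (entry c (Suc i))) \<and> entry c m = y"
    using v c by (intro exI[of _ c]) (simp del: entry.simps)
qed (unfold rec_eval_PrimRec_iff, blast)

lemma semidecidable_pred_rec_eval_Comp:
  assumes "semidecidable_pred (Suc (length gs)) (\<lambda>xs. rec_eval f (tl xs) (xs ! 0))"
    and "\<And>g. g \<in> set gs \<Longrightarrow> semidecidable_pred (Suc n) (\<lambda>xs. rec_eval g (tl xs) (xs ! 0))"
  shows "semidecidable_pred (Suc n) (\<lambda>xs. rec_eval (Comp f gs) (tl xs) (xs ! 0))"
  unfolding rec_eval_Comp_iff_ex_entry
  by (rule computable semidecidable_pred_all_less_const computable_map_map_upt
      semidecidable_pred_comp_Cons[OF assms(1)] semidecidable_pred_comp_Cons[OF assms(2)] | simp)+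

lemma semidecidable_pred_rec_eval_PrimRec:
  assumes "\<And>n. semidecidable_pred (Suc n) (\<lambda>xs. rec_eval f (tl xs) (xs ! 0))"
    and "\<And>n. semidecidable_pred (Suc n) (\<lambda>xs. rec_eval g (tl xs) (xs ! 0))"
  shows "semidecidable_pred (Suc n) (\<lambda>xs. rec_eval (PrimRec f g) (tl xs) (xs ! 0))"
proof (cases n)
  case 0
  then show ?thesis
    by (intro semidecidable_pred_cong[OF semidecidable_pred_atoms(1)[of _ False]])
      (auto simp: length_Suc_conv)
next
  case (Suc m)
  have "semidecidable_pred (Suc (Suc m)) (\<lambda>xs. \<exists>c. rec_eval f (tl (tl xs)) (entry c 0) \<and>
      (\<forall>i<tl xs ! 0. rec_eval g (i # entry c i # tl (tl xs)) (entry c (Suc i))) \<and>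
      entry c (tl xs ! 0) = xs ! 0)"
    by (rule computable semidecidable_pred_comp_Cons[OF assms(1)]
        semidecidable_pred_comp_Cons[OF assms(2)] | simp)+
  then show ?thesis
    unfolding Suc
    by (rule semidecidable_pred_cong)
      (auto simp: length_Suc_conv rec_eval_PrimRec_iff_ex_entry simp del: entry.simps)
qed

text \<open>Kleene's normal form, one program at a time: no universal machine is needed, as the universal
  function of an acceptable numbering is computed by a single program.\<close>

lemma semidecidable_pred_rec_eval:
  "semidecidable_pred (Suc n) (\<lambda>xs. rec_eval r (tl xs) (xs ! 0))"
proof (induction r arbitrary: n)
  case Zero
  show ?case unfolding rec_eval_simps by (rule computable | simp)+
next
  case Succ
  have "semidecidable_pred (Suc n) (\<lambda>xs. n = 1 \<and> xs ! 0 = Suc (tl xs ! 0))"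
    by (rule semidecidable_pred_const_conj computable | simp)+
  then show ?case by (rule semidecidable_pred_cong) (auto simp: length_Suc_conv)
next
  case (Proj i)
  have "semidecidable_pred (Suc n) (\<lambda>xs. i < n \<and> xs ! 0 = tl xs ! i)"
    by (rule semidecidable_pred_const_conj computable | simp)+
  then show ?case by (rule semidecidable_pred_cong) auto
next
  case (Comp f gs)
  then show ?case by (intro semidecidable_pred_rec_eval_Comp)
next
  case (PrimRec f g)
  then show ?case by (intro semidecidable_pred_rec_eval_PrimRec)
next
  case (Mu f)
  show ?case
    unfolding rec_eval_simps
    by (rule computable semidecidable_pred_comp_Cons[OF Mu.IH] | simp)+
qed

lemma semidecidable_pred_graph:
  assumes "partial_computable n f"
  shows "semidecidable_pred (Suc n) (\<lambda>xs. f (tl xs) = Some (xs ! 0))"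
proof -
  obtain r where "\<And>xs y. length xs = n \<Longrightarrow> f xs = Some y \<longleftrightarrow> rec_eval r xs y"
    using assms unfolding partial_computable_def by blast
  then show ?thesis
    by (intro semidecidable_pred_cong[OF semidecidable_pred_rec_eval[of n r]]) simp
qed

lemma partial_computable_if_semidecidable:
  assumes "semidecidable_pred n P"
  shows "\<exists>f. partial_computable n f \<and> (\<forall>xs. length xs = n \<longrightarrow> (P xs \<longleftrightarrow> f xs \<noteq> None))"
proof -
  obtain R where R: "decidable_pred (Suc n) (\<lambda>xs. R (xs ! 0) (tl xs))"
    "\<And>xs. length xs = n \<Longrightarrow> P xs \<longleftrightarrow> (\<exists>s. R s xs)"
    using assms by (rule semidecidable_predE) blast
  show ?thesis
    by (rule exI, rule conjI, rule partial_computable_Least[OF R(1)]) (simp add: R(2))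
qed

lemma Sigma02_nat_semidecidable_diff:
  assumes "semidecidable_pred 2 (\<lambda>xs. P (xs ! 0) (xs ! 1))"
    and "semidecidable_pred 2 (\<lambda>xs. Q (xs ! 0) (xs ! 1))"
  shows "Sigma02_nat {e. \<exists>a. P e a \<and> \<not> Q e a}"
proof -
  obtain R where R: "decidable_pred (Suc 2) (\<lambda>xs. R (xs ! 0) (tl xs))"
    "\<And>xs. length xs = 2 \<Longrightarrow> P (xs ! 0) (xs ! 1) \<longleftrightarrow> (\<exists>s. R s xs)"
    using assms(1) by (rule semidecidable_predE) blast
  obtain R' where R': "decidable_pred (Suc 2) (\<lambda>xs. R' (xs ! 0) (tl xs))"
    "\<And>xs. length xs = 2 \<Longrightarrow> Q (xs ! 0) (xs ! 1) \<longleftrightarrow> (\<exists>s. R' s xs)"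
    using assms(2) by (rule semidecidable_predE) blast
  define S where "S e z b \<longleftrightarrow> R (snd (prod_decode z)) [e, fst (prod_decode z)] \<and>
    \<not> R' b [e, fst (prod_decode z)]" for e z b
  have "decidable_pred 3 (\<lambda>xs. S (xs ! 0) (xs ! 1) (xs ! 2))"
    unfolding S_def
    by (rule computable decidable_pred_comp_Cons[OF R(1)[unfolded numeral_2_eq_2]]
        decidable_pred_comp_Cons[OF R'(1)[unfolded numeral_2_eq_2]] | simp)+
  moreover have "(\<exists>a. P e a \<and> \<not> Q e a) \<longleftrightarrow> (\<exists>z. \<forall>b. S e z b)" for e
    using R(2)[of "[e, _]"] R'(2)[of "[e, _]"]
      ex_prod_decode[of "\<lambda>a s. R s [e, a] \<and> (\<forall>b. \<not> R' b [e, a])"]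
    by (simp add: S_def)
  ultimately show ?thesis unfolding Sigma02_nat_def by auto
qed

section \<open>Effective open sets\<close>

definition uniformly_ce2 :: "(nat \<Rightarrow> nat \<Rightarrow> nat set) \<Rightarrow> bool" where
  "uniformly_ce2 J \<longleftrightarrow> semidecidable_pred 3 (\<lambda>xs. xs ! 2 \<in> J (xs ! 0) (xs ! 1))"

lemma semidecidable_pred_mem_ce2:
  assumes "uniformly_ce2 J" "total_computable n f" "total_computable n g" "total_computable n h"
  shows "semidecidable_pred n (\<lambda>xs. h xs \<in> J (f xs) (g xs))"
  using semidecidable_pred_comp[OF assms(1)[unfolded uniformly_ce2_def],
      of n "\<lambda>xs. [f xs, g xs, h xs]"] assms(2-)
  by (simp add: computable eval_nat_numeral)

lemma semidecidable_pred_numbering: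
  assumes "acceptable_numbering \<phi>"
    and "total_computable n e" "total_computable n m" "total_computable n y"
  shows "semidecidable_pred n (\<lambda>xs. \<phi> (e xs) (m xs) = Some (y xs))"
proof -
  have "partial_computable 2 (\<lambda>xs. \<phi> (xs ! 0) (xs ! 1))"
    using assms(1) unfolding acceptable_numbering_def by blast
  from semidecidable_pred_comp[OF semidecidable_pred_graph[OF this],
      of n "\<lambda>xs. [y xs, e xs, m xs]"]
  show ?thesis using assms(2-) by (simp add: computable eval_nat_numeral)
qed

lemma semidecidable_pred_mem_W:
  assumes "acceptable_numbering \<phi>" "total_computable n e" "total_computable n m"
  shows "semidecidable_pred n (\<lambda>xs. m xs \<in> W \<phi> (e xs))"
proof -
  have "semidecidable_pred n (\<lambda>xs. \<exists>y. \<phi> (e xs) (m xs) = Some y)"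
    by (rule computable semidecidable_pred_numbering[OF assms(1)] total_computable_comp[OF assms(2)]
        total_computable_comp[OF assms(3)] | simp)+
  then show ?thesis by (simp add: W_def dom_def)
qed

lemma acceptable_numbering_translate:
  assumes "acceptable_numbering \<phi>" "partial_computable 2 (\<lambda>xs. \<psi> (xs ! 0) (xs ! 1))"
  shows "\<exists>s. total_computable 1 (\<lambda>xs. s (xs ! 0)) \<and> (\<forall>i. \<phi> (s i) = \<psi> i)"
  using assms unfolding acceptable_numbering_def by simp

lemma ex_index_if_uniformly_ce2:
  assumes "acceptable_numbering \<phi>" "uniformly_ce2 J"
  shows "\<exists>h. total_computable 2 (\<lambda>xs. h (xs ! 0) (xs ! 1)) \<and> (\<forall>n k. W \<phi> (h n k) = J n k)"
proof -
  define J' where "J' z = J (fst (prod_decode z)) (snd (prod_decode z))" for z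
  have "semidecidable_pred 2 (\<lambda>xs. xs ! 1 \<in> J' (xs ! 0))"
    unfolding J'_def by (rule computable semidecidable_pred_mem_ce2[OF assms(2)] | simp)+
  then obtain f where f: "partial_computable 2 f"
    "\<And>xs. length xs = 2 \<Longrightarrow> xs ! 1 \<in> J' (xs ! 0) \<longleftrightarrow> f xs \<noteq> None"
    using partial_computable_if_semidecidable by blast
  have "[xs ! 0, xs ! 1] = xs" if "length xs = 2" for xs :: "nat list"
    using that by (auto simp: numeral_2_eq_2 length_Suc_conv)
  then have "partial_computable 2 (\<lambda>xs. f [xs ! 0, xs ! 1])"
    using f(1) by (simp add: partial_computable_def)
  from acceptable_numbering_translate[OF assms(1) this] obtain s where
    s: "total_computable 1 (\<lambda>xs. s (xs ! 0))" "\<And>z. \<phi> (s z) = (\<lambda>y. f [z, y])"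
    by auto
  have "W \<phi> (s (prod_encode (n, k))) = J n k" for n k
    using f(2)[of "[prod_encode (n, k), _]"] by (auto simp: W_def dom_def s(2) J'_def)
  moreover have "total_computable 2 (\<lambda>xs. s (prod_encode (xs ! 0, xs ! 1)))"
    by (rule computable total_computable_comp1[OF s(1)] | simp)+
  ultimately show ?thesis by (intro exI[of _ "\<lambda>n k. s (prod_encode (n, k))"]) simp
qed

lemma uniformly_effective_open2_iff:
  assumes "acceptable_numbering \<phi>"
  shows "uniformly_effective_open2 \<phi> B U \<longleftrightarrow>
    (\<exists>J. uniformly_ce2 J \<and> U = (\<lambda>n k. \<Union>y\<in>J n k. B y))"
proof
  assume "uniformly_effective_open2 \<phi> B U"
  then obtain h where h: "total_computable 2 (\<lambda>xs. h (xs ! 0) (xs ! 1))"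
    "\<And>n k. U n k = effective_open \<phi> B (h n k)"
    unfolding uniformly_effective_open2_def by blast
  have "uniformly_ce2 (\<lambda>n k. W \<phi> (h n k))"
    unfolding uniformly_ce2_def
    by (rule computable semidecidable_pred_mem_W[OF assms] total_computable_comp2[OF h(1)] | simp)+
  moreover have "U = (\<lambda>n k. \<Union>y\<in>W \<phi> (h n k). B y)"
    by (simp add: fun_eq_iff h(2) effective_open_def)
  ultimately show "\<exists>J. uniformly_ce2 J \<and> U = (\<lambda>n k. \<Union>y\<in>J n k. B y)" by blast
next
  assume "\<exists>J. uniformly_ce2 J \<and> U = (\<lambda>n k. \<Union>y\<in>J n k. B y)"
  then obtain J where J: "uniformly_ce2 J" "U = (\<lambda>n k. \<Union>y\<in>J n k. B y)" by blast
  from ex_index_if_uniformly_ce2[OF assms J(1)] show "uniformly_effective_open2 \<phi> B U"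
    unfolding uniformly_effective_open2_def effective_open_def J(2) by metis
qed

lemma uniformly_effective_open2I:
  assumes "acceptable_numbering \<phi>" "uniformly_ce2 J" "\<And>n k. U n k = (\<Union>y\<in>J n k. B y)"
  shows "uniformly_effective_open2 \<phi> B U"
  using assms(2-) unfolding uniformly_effective_open2_iff[OF assms(1)] by blast

text \<open>Open sets need not be countable unions of closed sets in a non-metrizable space, whence the
  differences.\<close>

definition uniformly_Sigma02 ::
    "(nat \<Rightarrow> nat \<Rightarrow> nat option) \<Rightarrow> (nat \<Rightarrow> 'a set) \<Rightarrow> (nat \<Rightarrow> 'a set) \<Rightarrow> bool" where
  "uniformly_Sigma02 \<phi> B S \<longleftrightarrow>
     (\<exists>U V. uniformly_effective_open2 \<phi> B U \<and> uniformly_effective_open2 \<phi> B V \<and>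
            S = (\<lambda>k. \<Union>n. U n k - V n k))"

lemma uniformly_Sigma02_iff:
  assumes "acceptable_numbering \<phi>"
  shows "uniformly_Sigma02 \<phi> B S \<longleftrightarrow>
    (\<exists>J K. uniformly_ce2 J \<and> uniformly_ce2 K \<and>
       S = (\<lambda>k. \<Union>n. (\<Union>y\<in>J n k. B y) - (\<Union>y\<in>K n k. B y)))"
  unfolding uniformly_Sigma02_def uniformly_effective_open2_iff[OF assms] by blast

lemma uniformly_Sigma02I:
  assumes "acceptable_numbering \<phi>" "uniformly_ce2 J" "uniformly_ce2 K"
    and "\<And>k. S k = (\<Union>n. (\<Union>y\<in>J n k. B y) - (\<Union>y\<in>K n k. B y))"
  shows "uniformly_Sigma02 \<phi> B S"
  unfolding uniformly_Sigma02_iff[OF assms(1)]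
  using assms(2-) by (intro exI[of _ J] exI[of _ K]) (simp add: fun_eq_iff)

definition interleave2 ::
    "(nat \<Rightarrow> nat \<Rightarrow> nat set) \<Rightarrow> (nat \<Rightarrow> nat \<Rightarrow> nat set) \<Rightarrow> nat \<Rightarrow> nat \<Rightarrow> nat set" where
  "interleave2 J J' z k = (let n = snd (prod_decode z) in
     if fst (prod_decode z) = 0 then J n k else J' n k)"

lemma uniformly_ce2_interleave2:
  assumes "uniformly_ce2 J" "uniformly_ce2 J'"
  shows "uniformly_ce2 (interleave2 J J')"
proof -
  have "semidecidable_pred 3 (\<lambda>xs.
      fst (prod_decode (xs ! 0)) = 0 \<and> xs ! 2 \<in> J (snd (prod_decode (xs ! 0))) (xs ! 1) \<or>
      0 < fst (prod_decode (xs ! 0)) \<and> xs ! 2 \<in> J' (snd (prod_decode (xs ! 0))) (xs ! 1))"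
    by (rule computable semidecidable_pred_mem_ce2[OF assms(1)]
        semidecidable_pred_mem_ce2[OF assms(2)] | simp)+
  then show ?thesis
    unfolding uniformly_ce2_def
    by (rule semidecidable_pred_cong) (simp add: interleave2_def Let_def)
qed

lemma uniformly_Sigma02_Un:
  assumes acceptable: "acceptable_numbering \<phi>"
    and "uniformly_Sigma02 \<phi> B S" "uniformly_Sigma02 \<phi> B S'"
  shows "uniformly_Sigma02 \<phi> B (\<lambda>k. S k \<union> S' k)"
proof -
  let ?diff = "\<lambda>J K n k. (\<Union>y\<in>J n k. B y) - (\<Union>y\<in>K n k. B y)"
  obtain J K where JK: "uniformly_ce2 J" "uniformly_ce2 K" and S: "S = (\<lambda>k. \<Union>n. ?diff J K n k)"
    using assms(2) unfolding uniformly_Sigma02_iff[OF acceptable] by blast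
  obtain J' K' where JK': "uniformly_ce2 J'" "uniformly_ce2 K'"
    and S': "S' = (\<lambda>k. \<Union>n. ?diff J' K' n k)"
    using assms(3) unfolding uniformly_Sigma02_iff[OF acceptable] by blast
  show ?thesis
  proof (rule uniformly_Sigma02I[OF acceptable uniformly_ce2_interleave2[OF JK(1) JK'(1)]
        uniformly_ce2_interleave2[OF JK(2) JK'(2)]], rule set_eqI)
    fix k x
    let ?P = "\<lambda>(c :: nat) n. if c = 0 then x \<in> ?diff J K n k else x \<in> ?diff J' K' n k"
    have "x \<in> S k \<union> S' k \<longleftrightarrow> (\<exists>n. ?P 0 n) \<or> (\<exists>n. ?P 1 n)"
      by (simp add: S S')
    also have "\<dots> \<longleftrightarrow> (\<exists>c n. ?P c n)"
      by (metis one_neq_zero)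
    also have "\<dots> \<longleftrightarrow> (\<exists>z. ?P (fst (prod_decode z)) (snd (prod_decode z)))"
      by (rule ex_prod_decode[symmetric])
    also have "\<dots> \<longleftrightarrow> x \<in> (\<Union>z. ?diff (interleave2 J J') (interleave2 K K') z k)"
      by (simp add: interleave2_def Let_def)
    finally show "x \<in> S k \<union> S' k \<longleftrightarrow>
        x \<in> (\<Union>z. ?diff (interleave2 J J') (interleave2 K K') z k)" .
  qed
qed

lemma bounded_Inter_iff_ex_chain:
  fixes B :: "'i \<Rightarrow> 'a set"
  assumes "\<And>i j. B i \<inter> B j = (\<Union>k\<in>M i j. B k)"
  shows "(x \<in> (\<Union>i. B i) \<and> (\<forall>e<N. x \<in> (\<Union>i\<in>J e. B i))) \<longleftrightarrow>
    (\<exists>j. (\<forall>e<N. \<exists>i\<in>J e. j (Suc e) \<in> M (j e) i) \<and> x \<in> B (j N))"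
proof (induction N)
  case 0
  show ?case by (auto intro: exI[of _ "\<lambda>_. _"])
next
  case (Suc N)
  let ?chain = "\<lambda>j N. \<forall>e<N. \<exists>i\<in>J e. j (Suc e) \<in> M (j e) i"
  have "x \<in> (\<Union>i. B i) \<and> (\<forall>e<Suc N. x \<in> (\<Union>i\<in>J e. B i)) \<longleftrightarrow>
      (\<exists>j. ?chain j N \<and> x \<in> B (j N)) \<and> x \<in> (\<Union>i\<in>J N. B i)"
    unfolding Suc.IH[symmetric] All_less_Suc by blast
  also have "\<dots> \<longleftrightarrow> (\<exists>j k. ?chain j N \<and> (\<exists>i\<in>J N. k \<in> M (j N) i) \<and> x \<in> B k)"
  proof -
    have "x \<in> B (j N) \<and> x \<in> B i \<longleftrightarrow> (\<exists>k\<in>M (j N) i. x \<in> B k)" for j i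
      using assms[of "j N" i] by blast
    then show ?thesis by blast
  qed
  also have "\<dots> \<longleftrightarrow> (\<exists>j. ?chain j (Suc N) \<and> x \<in> B (j (Suc N)))"
  proof
    assume "\<exists>j k. ?chain j N \<and> (\<exists>i\<in>J N. k \<in> M (j N) i) \<and> x \<in> B k"
    then obtain j k where "?chain j N" "\<exists>i\<in>J N. k \<in> M (j N) i" "x \<in> B k" by blast
    then show "\<exists>j. ?chain j (Suc N) \<and> x \<in> B (j (Suc N))"
      by (intro exI[of _ "j(Suc N := k)"]) (auto simp: less_Suc_eq)
  qed (auto simp: All_less_Suc)
  finally show ?case .
qed

lemma uniformly_effective_open2_bounded_Inter:
  assumes acceptable: "acceptable_numbering \<phi>" and X: "effective_topological_space \<phi> X B"
    and U: "uniformly_effective_open2 \<phi> B U" and t: "total_computable 1 (\<lambda>xs. t (xs ! 0))"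
  shows "uniformly_effective_open2 \<phi> B (\<lambda>c k. {x \<in> \<Union>(range B). \<forall>e<t k. x \<in> U (entry c e) e})"
proof -
  obtain J where J: "uniformly_ce2 J" "U = (\<lambda>n k. \<Union>y\<in>J n k. B y)"
    using U unfolding uniformly_effective_open2_iff[OF acceptable] by blast
  obtain g where g: "total_computable 2 (\<lambda>xs. g (xs ! 0) (xs ! 1))"
      "\<And>i j. B i \<inter> B j = (\<Union>k\<in>W \<phi> (g i j). B k)"
    using X unfolding effective_topological_space_def by blast
  define chain where "chain c N j \<longleftrightarrow>
      (\<forall>e<N. \<exists>i. i \<in> J (entry c e) e \<and> j (Suc e) \<in> W \<phi> (g (j e) i))" for c N j
  define L where "L c k = {y. \<exists>d. chain c (t k) (entry d) \<and> y = entry d (t k)}" for c k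
  have "uniformly_ce2 L"
    unfolding uniformly_ce2_def L_def chain_def mem_Collect_eq
    by (rule computable semidecidable_pred_mem_ce2[OF J(1)] semidecidable_pred_mem_W[OF acceptable]
        total_computable_comp2[OF g(1)] total_computable_comp1[OF t] | simp del: entry.simps)+
  then show ?thesis
  proof (rule uniformly_effective_open2I[OF acceptable])
    fix c k
    have "(\<exists>j. chain c (t k) j \<and> x \<in> B (j (t k))) \<longleftrightarrow>
        (\<exists>d. chain c (t k) (entry d) \<and> x \<in> B (entry d (t k)))" for x
    proof
      assume "\<exists>j. chain c (t k) j \<and> x \<in> B (j (t k))"
      then obtain j where j: "chain c (t k) j" "x \<in> B (j (t k))" by blast
      obtain d where "\<forall>e<Suc (t k). entry d e = j e" using ex_entry_eq by blast
      then show "\<exists>d. chain c (t k) (entry d) \<and> x \<in> B (entry d (t k))"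
        using j by (intro exI[of _ d]) (simp add: chain_def del: entry.simps)
    qed blast
    then show "{x \<in> \<Union>(range B). \<forall>e<t k. x \<in> U (entry c e) e} = (\<Union>y\<in>L c k. B y)"
      using bounded_Inter_iff_ex_chain[OF g(2), of _ "t k" "\<lambda>e. J (entry c e) e"]
      unfolding J(2) L_def chain_def[symmetric] Bex_def by auto
  qed
qed

lemma uniformly_Sigma02_bounded_Inter:
  assumes acceptable: "acceptable_numbering \<phi>" and X: "effective_topological_space \<phi> X B"
    and "uniformly_Sigma02 \<phi> B S" and t: "total_computable 1 (\<lambda>xs. t (xs ! 0))"
  shows "uniformly_Sigma02 \<phi> B (\<lambda>k. {x \<in> \<Union>(range B). \<forall>e<t k. x \<in> S e})"
proof -
  obtain U V where U: "uniformly_effective_open2 \<phi> B U" and V: "uniformly_effective_open2 \<phi> B V"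
    and S: "S = (\<lambda>k. \<Union>n. U n k - V n k)"
    using assms(3) unfolding uniformly_Sigma02_def by blast
  obtain K where K: "uniformly_ce2 K" "V = (\<lambda>n k. \<Union>y\<in>K n k. B y)"
    using V unfolding uniformly_effective_open2_iff[OF acceptable] by blast
  define U' where "U' c k = {x \<in> \<Union>(range B). \<forall>e<t k. x \<in> U (entry c e) e}" for c k
  define V' where "V' c k = (\<Union>e<t k. V (entry c e) e)" for c k
  have "uniformly_effective_open2 \<phi> B U'"
    unfolding U'_def by (rule uniformly_effective_open2_bounded_Inter[OF acceptable X U t])
  moreover have "uniformly_effective_open2 \<phi> B V'"
  proof -
    have "uniformly_ce2 (\<lambda>c k. {y. \<exists>e. e < t k \<and> y \<in> K (entry c e) e})"
      unfolding uniformly_ce2_def mem_Collect_eq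
      by (rule computable semidecidable_pred_mem_ce2[OF K(1)] total_computable_comp1[OF t] | simp)+
    then show ?thesis
      by (rule uniformly_effective_open2I[OF acceptable]) (auto simp: V'_def K(2))
  qed
  moreover have "{x \<in> \<Union>(range B). \<forall>e<t k. x \<in> S e} = (\<Union>c. U' c k - V' c k)" for k
    using all_less_ex_iff_ex_entry[of "t k" "\<lambda>e n. _ \<in> U n e - V n e"]
    unfolding S U'_def V'_def by auto
  ultimately show ?thesis unfolding uniformly_Sigma02_def by blast
qed

section \<open>Markov names\<close>

lemma markov_name_iff:
  "markov_name \<phi> B x e \<longleftrightarrow>
    (\<forall>m. \<exists>y. \<phi> e m = Some y \<and> x \<in> B y) \<and> (\<forall>i. x \<in> B i \<longrightarrow> (\<exists>m. \<phi> e m = Some i))"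
proof
  assume "markov_name \<phi> B x e"
  then obtain p where p: "\<And>m. \<phi> e m = Some (p m)" "range p = {i. x \<in> B i}"
    unfolding markov_name_def type2_name_def by blast
  have "x \<in> B (p m)" for m using p(2) by blast
  moreover have "\<exists>m. p m = i" if "x \<in> B i" for i using p(2) that by (metis imageE mem_Collect_eq)
  ultimately show "(\<forall>m. \<exists>y. \<phi> e m = Some y \<and> x \<in> B y) \<and>
      (\<forall>i. x \<in> B i \<longrightarrow> (\<exists>m. \<phi> e m = Some i))"
    by (simp add: p(1))
next
  assume name: "(\<forall>m. \<exists>y. \<phi> e m = Some y \<and> x \<in> B y) \<and>
      (\<forall>i. x \<in> B i \<longrightarrow> (\<exists>m. \<phi> e m = Some i))"
  then obtain p where p: "\<And>m. \<phi> e m = Some (p m)" "\<And>m. x \<in> B (p m)" by metis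
  then have "range p = {i. x \<in> B i}" using name by auto
  then show "markov_name \<phi> B x e" unfolding markov_name_def type2_name_def using p(1) by blast
qed

lemma mem_Union_iff_markov_name:
  assumes "markov_name \<phi> B x e"
  shows "x \<in> (\<Union>y\<in>J. B y) \<longleftrightarrow> (\<exists>m y. \<phi> e m = Some y \<and> y \<in> J)"
  using assms unfolding markov_name_iff by (metis UN_iff option.inject)

lemma ex_markov_name:
  assumes "acceptable_numbering \<phi>" "x \<in> computable_points X B"
  shows "\<exists>e. markov_name \<phi> B x e"
proof -
  obtain p where p: "total_computable 1 (\<lambda>xs. p (xs ! 0))" "type2_name B x p"
    using assms(2) unfolding computable_points_def by blast
  have "total_computable 2 (\<lambda>xs. p (xs ! 1))"
    by (rule computable total_computable_comp1[OF p(1)] | simp)+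
  then obtain s :: "nat \<Rightarrow> nat" where "\<And>i. \<phi> (s i) = (\<lambda>n. Some (p n))"
    using acceptable_numbering_translate[OF assms(1), of "\<lambda>_ n. Some (p n)"]
    unfolding total_computable_def by blast
  then have "markov_name \<phi> B x (s 0)" using p(2) unfolding markov_name_def by auto
  then show ?thesis by blast
qed

lemma program_length_le_iff: "program_length e \<le> k \<longleftrightarrow> Suc e < 2 ^ Suc k"
proof
  assume "program_length e \<le> k"
  have "Suc e < 2 ^ Suc (program_length e)"
    using floor_log_exp2_gt[of "Suc e"] by (simp add: program_length_def)
  also have "\<dots> \<le> 2 ^ Suc k" using \<open>program_length e \<le> k\<close> by (intro power_increasing) simp_all
  finally show "Suc e < 2 ^ Suc k" .
next
  have "2 ^ program_length e \<le> Suc e"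
    using floor_log_exp2_le[of "Suc e"] by (simp add: program_length_def)
  also assume "Suc e < 2 ^ Suc k"
  finally show "program_length e \<le> k" by (simp add: less_Suc_eq_le del: power_Suc)
qed

lemma total_computable_program_length [computable]:
  assumes "total_computable n f"
  shows "total_computable n (\<lambda>xs. program_length (f xs))"
proof (rule total_computable_comp1[OF _ assms])
  have "(LEAST k. Suc e < 2 ^ Suc k) = program_length e" for e
    by (intro Least_equality) (simp_all only: program_length_le_iff[symmetric] order_refl)
  moreover have "total_computable 1 (\<lambda>xs. LEAST k. Suc (xs ! 0) < 2 ^ Suc k)"
  proof (rule total_computable_Least)
    show "decidable_pred (Suc 1) (\<lambda>xs. Suc (tl xs ! 0) < 2 ^ Suc (xs ! 0))"
      by (rule computable | simp del: power_Suc)+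
  qed (use program_length_le_iff in blast)
  ultimately show "total_computable 1 (\<lambda>xs. program_length (xs ! 0))" by simp
qed

lemma Least_le_iff:
  fixes k :: "'a::wellorder"
  assumes "\<exists>l. P l"
  shows "(LEAST l. P l) \<le> k \<longleftrightarrow> (\<exists>l\<le>k. P l)"
  using assms by (meson LeastI_ex Least_le order_trans)

lemma mem_computable_points_upto_iff:
  assumes "acceptable_numbering \<phi>"
  shows "x \<in> computable_points_upto \<phi> X B k \<longleftrightarrow>
    x \<in> computable_points X B \<and> (\<exists>e. markov_name \<phi> B x e \<and> program_length e \<le> k)"
proof -
  have "point_complexity \<phi> B x \<le> k \<longleftrightarrow> (\<exists>l\<le>k. \<exists>e. markov_name \<phi> B x e \<and> program_length e = l)"
    if "x \<in> computable_points X B"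
    unfolding point_complexity_def using ex_markov_name[OF assms that] by (intro Least_le_iff) blast
  then show ?thesis unfolding computable_points_upto_def by blast
qed

section \<open>The equivalence\<close>

lemma uniformly_Sigma02_not_markov_name:
  assumes "acceptable_numbering \<phi>"
  shows "uniformly_Sigma02 \<phi> B (\<lambda>e. {x \<in> \<Union>(range B). \<not> markov_name \<phi> B x e})"
proof -
  have ce: "uniformly_ce2 (\<lambda>m e. UNIV)" "uniformly_ce2 (\<lambda>m e. {y. \<phi> e m = Some y})"
    "uniformly_ce2 (\<lambda>i e. {y. y = i})" "uniformly_ce2 (\<lambda>i e. {y. \<exists>m. \<phi> e m = Some i})"
    unfolding uniformly_ce2_def mem_Collect_eq
    by (rule computable semidecidable_pred_numbering[OF assms] | simp)+
  have "uniformly_Sigma02 \<phi> B (\<lambda>e. \<Union>m. (\<Union>y\<in>UNIV. B y) - (\<Union>y\<in>{y. \<phi> e m = Some y}. B y))"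
    (is "uniformly_Sigma02 \<phi> B ?outside")
    by (rule uniformly_Sigma02I[OF assms ce(1,2)]) simp
  moreover have "uniformly_Sigma02 \<phi> B
      (\<lambda>e. \<Union>i. (\<Union>y\<in>{y. y = i}. B y) - (\<Union>y\<in>{y. \<exists>m. \<phi> e m = Some i}. B y))"
    (is "uniformly_Sigma02 \<phi> B ?unlisted")
    by (rule uniformly_Sigma02I[OF assms ce(3,4)]) simp
  moreover have "{x \<in> \<Union>(range B). \<not> markov_name \<phi> B x e} = ?outside e \<union> ?unlisted e" for e
    unfolding markov_name_iff by blast
  ultimately show ?thesis by (simp only: uniformly_Sigma02_Un[OF assms])
qed

lemma uniformly_Sigma02_mem_Sigma02_nat:
  assumes "acceptable_numbering \<phi>" "Sigma02_nat I"
  shows "uniformly_Sigma02 \<phi> B (\<lambda>e. {x \<in> \<Union>(range B). e \<in> I})"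
proof -
  obtain R where R: "decidable_pred 3 (\<lambda>xs. R (xs ! 0) (xs ! 1) (xs ! 2))"
      "I = {e. \<exists>a. \<forall>b. R e a b}"
    using assms(2) unfolding Sigma02_nat_def by blast
  have "semidecidable_pred 3 (\<lambda>xs. \<exists>b. \<not> R (xs ! 1) (xs ! 0) b)"
    by (rule computable semidecidable_pred_decidable decidable_pred_comp3[OF R(1)] | simp)+
  then have "uniformly_ce2 (\<lambda>a e. {y. \<exists>b. \<not> R e a b})"
    unfolding uniformly_ce2_def by simp
  moreover have "uniformly_ce2 (\<lambda>a e. UNIV)"
    unfolding uniformly_ce2_def by (simp add: computable)
  moreover have "{x \<in> \<Union>(range B). e \<in> I} =
      (\<Union>a. (\<Union>y\<in>UNIV. B y) - (\<Union>y\<in>{y. \<exists>b. \<not> R e a b}. B y))" for e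
    unfolding R(2) by blast
  ultimately show ?thesis by (intro uniformly_Sigma02I[OF assms(1)])
qed

lemma ex_uniformly_Sigma02_if_Sigma02_nat:
  assumes acceptable: "acceptable_numbering \<phi>" and X: "effective_topological_space \<phi> X B"
    and I: "Sigma02_nat I"
    and A: "\<forall>x \<in> computable_points X B. \<forall>e. markov_name \<phi> B x e \<longrightarrow> (x \<in> A \<longleftrightarrow> e \<in> I)"
  shows "\<exists>S. uniformly_Sigma02 \<phi> B S \<and>
    (\<forall>k. A \<inter> computable_points_upto \<phi> X B k = S k \<inter> computable_points_upto \<phi> X B k)"
proof -
  define D where "D e = {x \<in> \<Union>(range B). \<not> markov_name \<phi> B x e} \<union> {x \<in> \<Union>(range B). e \<in> I}" for e
  define S where "S k = {x \<in> \<Union>(range B). \<forall>e<2 ^ Suc k. x \<in> D e}" for k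
  have D: "uniformly_Sigma02 \<phi> B D"
    unfolding D_def
    by (intro uniformly_Sigma02_Un uniformly_Sigma02_not_markov_name
        uniformly_Sigma02_mem_Sigma02_nat acceptable I)
  have "total_computable 1 (\<lambda>xs. 2 ^ Suc (xs ! 0))"
    by (rule computable | simp del: power_Suc)+
  then have "uniformly_Sigma02 \<phi> B S"
    unfolding S_def by (rule uniformly_Sigma02_bounded_Inter[OF acceptable X D])
  moreover have "x \<in> A \<longleftrightarrow> x \<in> S k" if x: "x \<in> computable_points_upto \<phi> X B k" for x k
  proof -
    obtain e where e: "x \<in> computable_points X B" "markov_name \<phi> B x e" "Suc e < 2 ^ Suc k"
      using x unfolding mem_computable_points_upto_iff[OF acceptable] program_length_le_iff by blast
    have "x \<in> \<Union>(range B)" using e(2) unfolding markov_name_iff by blast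
    moreover have "e < 2 ^ Suc k" using e(3) by simp
    ultimately show ?thesis using A e unfolding S_def D_def by blast
  qed
  ultimately show ?thesis by blast
qed

lemma ex_Sigma02_nat_if_uniformly_Sigma02:
  assumes acceptable: "acceptable_numbering \<phi>" and S: "uniformly_Sigma02 \<phi> B S"
    and A: "\<forall>k. A \<inter> computable_points_upto \<phi> X B k = S k \<inter> computable_points_upto \<phi> X B k"
  shows "\<exists>I. Sigma02_nat I \<and>
    (\<forall>x \<in> computable_points X B. \<forall>e. markov_name \<phi> B x e \<longrightarrow> (x \<in> A \<longleftrightarrow> e \<in> I))"
proof -
  obtain J K where JK: "uniformly_ce2 J" "uniformly_ce2 K"
    "S = (\<lambda>k. \<Union>n. (\<Union>y\<in>J n k. B y) - (\<Union>y\<in>K n k. B y))"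
    using S unfolding uniformly_Sigma02_iff[OF acceptable] by blast
  define hits where "hits L e n \<longleftrightarrow> (\<exists>m y. \<phi> e m = Some y \<and> y \<in> L n (program_length e))"
    for L :: "nat \<Rightarrow> nat \<Rightarrow> nat set" and e n
  have "semidecidable_pred 2 (\<lambda>xs. hits L (xs ! 0) (xs ! 1))" if "uniformly_ce2 L" for L
    unfolding hits_def
    by (rule computable semidecidable_pred_numbering[OF acceptable]
        semidecidable_pred_mem_ce2[OF that] | simp)+
  then have "Sigma02_nat {e. \<exists>n. hits J e n \<and> \<not> hits K e n}"
    using JK(1,2) by (intro Sigma02_nat_semidecidable_diff)
  moreover have "x \<in> A \<longleftrightarrow> (\<exists>n. hits J e n \<and> \<not> hits K e n)"
    if x: "x \<in> computable_points X B" and e: "markov_name \<phi> B x e" for x e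
  proof -
    have "x \<in> computable_points_upto \<phi> X B (program_length e)"
      unfolding mem_computable_points_upto_iff[OF acceptable] using x e by blast
    then have "x \<in> A \<longleftrightarrow> x \<in> S (program_length e)" using A by blast
    then show ?thesis
      unfolding JK(3) hits_def mem_Union_iff_markov_name[OF e, symmetric] by blast
  qed
  ultimately show ?thesis by blast
qed

theorem mainTheorem7:
  fixes \<phi> :: "nat \<Rightarrow> nat \<Rightarrow> nat option"
    and X :: "'a topology"
    and B :: "nat \<Rightarrow> 'a set"
    and A :: "'a set"
  assumes "acceptable_numbering \<phi>"
    and "effective_topological_space \<phi> X B"
    and "Pi02_baire \<phi> (type2_names X B)"
    and "A \<subseteq> computable_points X B"
  shows "(\<exists>I. Sigma02_nat I \<and>
            (\<forall>x \<in> computable_points X B. \<forall>e. markov_name \<phi> B x e \<longrightarrow> (x \<in> A \<longleftrightarrow> e \<in> I)))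
     \<longleftrightarrow>
         (\<exists>U V. uniformly_effective_open2 \<phi> B U \<and> uniformly_effective_open2 \<phi> B V \<and>
            (\<forall>k. A \<inter> computable_points_upto \<phi> X B k =
                 (\<Union>n. U n k - V n k) \<inter> computable_points_upto \<phi> X B k))"
  (is "?index \<longleftrightarrow> ?differences")
proof
  assume ?index
  then obtain I where "Sigma02_nat I"
    "\<forall>x \<in> computable_points X B. \<forall>e. markov_name \<phi> B x e \<longrightarrow> (x \<in> A \<longleftrightarrow> e \<in> I)" by blast
  from ex_uniformly_Sigma02_if_Sigma02_nat[OF assms(1,2) this] show ?differences
    unfolding uniformly_Sigma02_def by auto
next
  assume ?differences
  then obtain U V where "uniformly_effective_open2 \<phi> B U" "uniformly_effective_open2 \<phi> B V"
    and differences: "\<forall>k. A \<inter> computable_points_upto \<phi> X B k =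
      (\<Union>n. U n k - V n k) \<inter> computable_points_upto \<phi> X B k" by blast
  then have "uniformly_Sigma02 \<phi> B (\<lambda>k. \<Union>n. U n k - V n k)"
    unfolding uniformly_Sigma02_def by blast
  from ex_Sigma02_nat_if_uniformly_Sigma02[OF assms(1) this differences] show ?index .
qed

end
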